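(* Let $S$ be a bounded semilattice. If $G(S)$ contains a cycle, then $\mathrm{girth}(G(S))=3$.
   Context: A bounded semilattice $(S,\cdot,0,1)$ is a commutative semigroup whose operation is idempotent ($x\cdot x=x$ for all $x$), with a neutral element $1$ and an absorbing element $0$; it is partially ordered by $x\le y \iff x\cdot y=x$, so that $0\le x\le 1$. The graph $G(S)$ is the simple graph with vertex set $S\setminus\{0,1\}$ in which two vertices $x,y$ are adjacent iff $x\ne y$ and $x\cdot y\neq 0$. The girth of a graph is the minimum length of a cycle contained in it. *)

theory Defs
  imports "Graph_Theory.Graph_Theory" "HOL-Library.Extended_Nat"
begin

text \<open>The induced order, in which \<open>x\<close> is below \<open>y\<close> iff \<open>x \<^bold>* y = x\<close>, is left implicit.
  \<open>zero\<close> and the neutral element are not required to be distinct.\<close>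

locale bounded_semilattice = semilattice_neutr +
  fixes zero :: 'a  (\<open>\<^bold>0\<close>)
  assumes absorbing: "\<^bold>0 \<^bold>* x = \<^bold>0"

text \<open>A simple graph is represented as a symmetric, loop-free digraph without parallel arcs: an
  undirected edge between \<open>x\<close> and \<open>y\<close> is the pair of arcs \<open>(x, y)\<close> and \<open>(y, x)\<close>.\<close>

definition semilattice_graph :: "('a \<Rightarrow> 'a \<Rightarrow> 'a) \<Rightarrow> 'a \<Rightarrow> 'a \<Rightarrow> 'a pair_pre_digraph" where
  "semilattice_graph f one zero =
    \<lparr> pverts = UNIV - {zero, one},
      parcs = {(x, y). x \<in> UNIV - {zero, one} \<and> y \<in> UNIV - {zero, one} \<and>
                       x \<noteq> y \<and> f x y \<noteq> zero} \<rparr>"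

lemma (in bounded_semilattice) semilattice_graph_simple:
  "pair_bidirected_digraph (semilattice_graph (\<^bold>*) \<^bold>1 \<^bold>0)"
  by unfold_locales
    (auto simp: semilattice_graph_def symmetric_def sym_def commute)

text \<open>A directed cycle may traverse an edge back and forth, as in \<open>x, y, x\<close>; this is the only
  kind of directed cycle in a symmetric loop-free digraph that is not a cycle of the underlying
  undirected graph, and it is excluded by the bound on the length.\<close>

definition undirected_cycle :: "'a pair_pre_digraph \<Rightarrow> ('a \<times> 'a) awalk \<Rightarrow> bool" where
  "undirected_cycle G p \<longleftrightarrow> pre_digraph.cycle (with_proj G) p \<and> length p \<ge> 3"

text \<open>The infimum over the empty set is \<open>\<infinity>\<close>, so acyclic graphs have infinite girth; otherwise
  the infimum is a minimum.\<close>

definition girth :: "'a pair_pre_digraph \<Rightarrow> enat" where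
  "girth G = (INF p \<in> {p. undirected_cycle G p}. enat (length p))"

end

theory Submission
  imports Defs
begin

text \<open>The product of two adjacent vertices is adjacent to both of them unless it equals one of
  them. Hence in a triangle-free \<open>G(S)\<close> adjacent vertices are comparable, and along a path
  \<open>a, b, c, d\<close> either two consecutive comparisons point the same way or \<open>b\<close> or \<open>c\<close> lies below both
  of its neighbours; each case makes two vertices at distance two on the path adjacent. A cycle of
  length at least four contains such a path.\<close>

abbreviation adjacent :: "('a \<Rightarrow> 'a \<Rightarrow> 'a) \<Rightarrow> 'a \<Rightarrow> 'a \<Rightarrow> 'a \<Rightarrow> 'a \<Rightarrow> bool" where
  "adjacent f one zero x y \<equiv> (x, y) \<in> parcs (semilattice_graph f one zero)"

lemma adjacent_iff:
  "adjacent f one zero x y \<longleftrightarrow>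
    x \<noteq> zero \<and> x \<noteq> one \<and> y \<noteq> zero \<and> y \<noteq> one \<and> x \<noteq> y \<and> f x y \<noteq> zero"
  by (auto simp: semilattice_graph_def)

context bounded_semilattice
begin

lemma mult_zero_right: "x \<^bold>* \<^bold>0 = \<^bold>0"
  using absorbing commute by metis

text \<open>The neutral element is the top of the order, and a product lies below each of its
  factors.\<close>

lemma mult_eq_one_imp: "x \<^bold>* y = \<^bold>1 \<Longrightarrow> x = \<^bold>1"
  by (metis left_idem right_neutral)

text \<open>In the order, \<open>u\<close> lies below \<open>x\<close> and \<open>y\<close>, hence
  below their product; were the product zero, \<open>u\<close> would be zero as well. Likewise
  neither \<open>x\<close> nor \<open>y\<close> can be zero.\<close>

lemma adjacent_common_lower_bound:
  assumes "u \<noteq> \<^bold>0" "x \<^bold>* u = u" "y \<^bold>* u = u" "x \<noteq> y" "x \<noteq> \<^bold>1" "y \<noteq> \<^bold>1"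
  shows "adjacent (\<^bold>*) \<^bold>1 \<^bold>0 x y"
proof -
  have "(x \<^bold>* y) \<^bold>* u = u"
    using assms by (simp add: assoc)
  then show ?thesis
    using assms absorbing by (metis adjacent_iff)
qed

lemma adjacent_comparable_or_triangle:
  assumes "adjacent (\<^bold>*) \<^bold>1 \<^bold>0 x y"
  obtains "x \<^bold>* y = x" | "x \<^bold>* y = y"
  | u where "adjacent (\<^bold>*) \<^bold>1 \<^bold>0 y u" "adjacent (\<^bold>*) \<^bold>1 \<^bold>0 x u"
proof (cases "x \<^bold>* y = x \<or> x \<^bold>* y = y")
  case False
  let ?w = "x \<^bold>* y"
  have "x \<^bold>* ?w = ?w" "y \<^bold>* ?w = ?w" "?w \<^bold>* ?w = ?w"
    by (simp_all add: left_commute)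
  moreover have "?w \<noteq> \<^bold>1"
    using assms mult_eq_one_imp by (auto simp: adjacent_iff)
  \<comment> \<open>\<open>?w\<close> is both the third vertex of the triangle and the nonzero
    common lower bound: it lies below itself and below each factor.\<close>
  ultimately show ?thesis
    using that(3)[of ?w] adjacent_common_lower_bound[of ?w] assms False
    by (metis adjacent_iff)
qed (use that in blast)

lemma path_imp_triangle:
  assumes ab: "adjacent (\<^bold>*) \<^bold>1 \<^bold>0 a b" and bc: "adjacent (\<^bold>*) \<^bold>1 \<^bold>0 b c"
    and cd: "adjacent (\<^bold>*) \<^bold>1 \<^bold>0 c d" and ne: "a \<noteq> c" "b \<noteq> d"
  shows "\<exists>x y u. adjacent (\<^bold>*) \<^bold>1 \<^bold>0 x y \<and> adjacent (\<^bold>*) \<^bold>1 \<^bold>0 y u \<and> adjacent (\<^bold>*) \<^bold>1 \<^bold>0 x u"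
proof (rule ccontr)
  assume no: "\<not> ?thesis"
  have comp: "x \<^bold>* y = x \<or> x \<^bold>* y = y" if "adjacent (\<^bold>*) \<^bold>1 \<^bold>0 x y" for x y
    using adjacent_comparable_or_triangle[OF that] that no by metis
  have "\<not> adjacent (\<^bold>*) \<^bold>1 \<^bold>0 a c" "\<not> adjacent (\<^bold>*) \<^bold>1 \<^bold>0 b d"
    using no ab bc cd by blast+
  then have ac: "a \<^bold>* c = \<^bold>0" and bd: "b \<^bold>* d = \<^bold>0"
    using ab bc cd ne by (auto simp: adjacent_iff)
  show False
  proof (cases "b \<^bold>* c = b")
    case True
    \<comment> \<open>Here \<open>b\<close> \<le> \<open>c\<close>. If \<open>a\<close> \<le>
      \<open>b\<close>, then \<open>a\<close> \<le> \<open>c\<close>, so \<open>a\<close> is the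
      product of \<open>a\<close> and \<open>c\<close>, which is zero. If \<open>b\<close> \<le>
      \<open>a\<close>, then \<open>b\<close> lies below that same product.\<close>
    then show False
      using comp[OF ab] ac ab mult_zero_right absorbing
      by (metis adjacent_iff assoc commute)
  next
    case False
    then have "b \<^bold>* c = c"
      using comp[OF bc] by blast
    \<comment> \<open>Now \<open>c\<close> \<le> \<open>b\<close>. If \<open>c\<close> \<le>
      \<open>d\<close>, then \<open>c\<close> lies below the zero product of \<open>b\<close> and
      \<open>d\<close>; if \<open>d\<close> \<le> \<open>c\<close>, then \<open>d\<close> \<le>
      \<open>b\<close>, so \<open>d\<close> equals that product.\<close>
    then show False
      using comp[OF cd] bd cd mult_zero_right absorbing
      by (metis adjacent_iff assoc commute)
  qed
qed

end

lemma undirected_cycle_triangle: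
  assumes "adjacent f one zero x y" "adjacent f one zero y z" "adjacent f one zero z x"
  shows "undirected_cycle (semilattice_graph f one zero) [(x, y), (y, z), (z, x)]"
  using assms
  by (auto simp: undirected_cycle_def pre_digraph.cycle_def pre_digraph.awalk_def
      pre_digraph.cas.simps pre_digraph.awalk_verts.simps semilattice_graph_def)

lemma undirected_cycle_length_gt_3_path:
  assumes "undirected_cycle (semilattice_graph f one zero) p" "length p > 3"
  obtains a b c d where "adjacent f one zero a b" "adjacent f one zero b c"
    "adjacent f one zero c d" "a \<noteq> c" "b \<noteq> d"
proof -
  obtain e1 e2 e3 e4 q where p: "p = e1 # e2 # e3 # e4 # q"
    using assms(2) by (auto simp: numeral_3_eq_3 Suc_less_eq2 length_Suc_conv neq_Nil_conv)
  \<comment> \<open>The path starts at the second arc, so its vertices are the heads of the first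
    four arcs (\<open>fst e2\<close> is the head of \<open>e1\<close>). A cycle has pairwise
    distinct heads, which gives both inequalities.\<close>
  show ?thesis
    using assms(1) that[of "fst e2" "snd e2" "snd e3" "snd e4"] unfolding p
    by (cases e1; cases e2; cases e3; cases e4; cases q)
      (auto simp: undirected_cycle_def pre_digraph.cycle_def pre_digraph.awalk_def
        pre_digraph.cas.simps pre_digraph.awalk_verts.simps)
qed

theorem theorem3p6:
  fixes f :: "'a \<Rightarrow> 'a \<Rightarrow> 'a" and one zero :: 'a
  assumes "bounded_semilattice f one zero"
    and "\<exists>p. undirected_cycle (semilattice_graph f one zero) p"
  shows "girth (semilattice_graph f one zero) = 3"
proof -
  interpret bounded_semilattice f one zero by fact
  let ?G = "semilattice_graph f one zero"
  obtain p where p: "undirected_cycle ?G p"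
    using assms(2) by blast
  have "\<exists>q. undirected_cycle ?G q \<and> length q = 3"
  proof (cases "length p = 3")
    case False
    then have "length p > 3"
      using p by (simp add: undirected_cycle_def)
    then obtain x y z where "adjacent f one zero x y" "adjacent f one zero y z"
      "adjacent f one zero x z"
      using undirected_cycle_length_gt_3_path[OF p] path_imp_triangle by metis
    moreover from this have "adjacent f one zero z x"
      by (auto simp: adjacent_iff commute)
    ultimately have "undirected_cycle ?G [(x, y), (y, z), (z, x)]"
      by (intro undirected_cycle_triangle)
    then show ?thesis
      by (intro exI[of _ "[(x, y), (y, z), (z, x)]"]) simp
  qed (use p in blast)
  then obtain q where q: "undirected_cycle ?G q" "length q = 3"
    by blast
  show ?thesis
  proof (rule antisym)
    show "girth ?G \<le> 3"
      unfolding girth_def using q by (intro INF_lower2[of q]) (auto simp: numeral_eq_enat)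
    \<comment> \<open>This bound is the length condition built into
      \<open>undirected_cycle\<close>.\<close>
    show "3 \<le> girth ?G"
      unfolding girth_def by (intro INF_greatest) (auto simp: undirected_cycle_def numeral_eq_enat)
  qed
qed

end
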